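(* For every integer $n \ge 3$, $$\operatorname{La}^{\#}(n,Y,Y') = \Sigma(n,2).$$
   Context: $[n]=\{1,\dots,n\}$ and $2^{[n]}$ is its power set. $\Sigma(n,k)$ denotes the sum of the $k$ largest binomial coefficients of the form $\binom{n}{i}$, $0\le i\le n$. A family $\mathcal{A}\subset 2^{[n]}$ is viewed as a poset under inclusion. A poset $P$ is an induced subposet of a poset $Q$ if there is an injection $\phi:P\to Q$ such that $x\le y$ in $P$ if and only if $\phi(x)\le\phi(y)$ in $Q$. $\operatorname{La}^{\#}(n,P,Q)$ is the size of the largest family $\mathcal{A}\subset 2^{[n]}$ containing neither $P$ nor $Q$ as an induced subposet. $Y$ is the poset on $4$ distinct elements $w,x,y,z$ whose order is generated by $w\le x$, $x\le y$ and $x\le z$ (so $y$ and $z$ are incomparable). $Y'$ is the poset obtained from $Y$ by reversing all relations. *)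

theory Defs
  imports Main
begin

text \<open>
  A poset is represented by its reflexive order relation, pairs \<open>(x, y)\<close> standing for
  \<open>x \<le> y\<close>; its ground set is the \<^const>\<open>Field\<close> of the relation.
\<close>

definition induced_subposet :: "'a rel \<Rightarrow> 'b rel \<Rightarrow> bool" where
  "induced_subposet P Q \<longleftrightarrow>
     (\<exists>\<phi>. inj_on \<phi> (Field P) \<and> \<phi> ` Field P \<subseteq> Field Q \<and>
        (\<forall>x\<in>Field P. \<forall>y\<in>Field P. (x, y) \<in> P \<longleftrightarrow> (\<phi> x, \<phi> y) \<in> Q))"

definition inclusion_poset :: "'a set set \<Rightarrow> 'a set rel" where
  "inclusion_poset \<A> = relation_of (\<subseteq>) \<A>"

definition La_induced :: "nat \<Rightarrow> 'a rel \<Rightarrow> 'b rel \<Rightarrow> nat" where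
  "La_induced n P Q =
     Max {card \<A> | \<A>. \<A> \<subseteq> Pow {1..n} \<and>
       \<not> induced_subposet P (inclusion_poset \<A>) \<and>
       \<not> induced_subposet Q (inclusion_poset \<A>)}"

text \<open>
  The list has one entry per index \<open>i\<close>, so equal binomial coefficients are counted with
  multiplicity.
\<close>

definition sum_largest_binomials :: "nat \<Rightarrow> nat \<Rightarrow> nat" where
  "sum_largest_binomials n k =
     sum_list (take k (rev (sort (map (\<lambda>i. n choose i) [0..<Suc n]))))"

datatype Y_elem = Y_w | Y_x | Y_y | Y_z

definition Y_poset :: "Y_elem rel" where
  "Y_poset = {(Y_w, Y_x), (Y_x, Y_y), (Y_x, Y_z)}\<^sup>*"

abbreviation Y_dual :: "Y_elem rel" where
  "Y_dual \<equiv> Y_poset\<inverse>"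

lemma Field_inclusion_poset [simp]: "Field (inclusion_poset \<A>) = \<A>"
  by (auto simp: inclusion_poset_def relation_of_def Field_def)

lemma Partial_order_inclusion_poset: "Partial_order (inclusion_poset \<A>)"
  by (auto simp: inclusion_poset_def relation_of_def Field_def partial_order_on_def
      preorder_on_def refl_on_def trans_def antisym_def)

lemma Field_Y_poset [simp]: "Field Y_poset = UNIV"
  by (auto simp: Y_poset_def Field_def)

lemma Y_poset_eq:
  "Y_poset = Id \<union> {(Y_w, Y_x), (Y_w, Y_y), (Y_w, Y_z), (Y_x, Y_y), (Y_x, Y_z)}"
  (is "_ = ?R")
proof
  show "Y_poset \<subseteq> ?R"
  proof
    fix p assume "p \<in> Y_poset"
    then obtain a b where p: "p = (a, b)"
      and ab: "(a, b) \<in> {(Y_w, Y_x), (Y_x, Y_y), (Y_x, Y_z)}\<^sup>*"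
      by (cases p) (auto simp: Y_poset_def)
    from ab have "(a, b) \<in> ?R" by (induction rule: rtrancl_induct) auto
    then show "p \<in> ?R" using p by simp
  qed
next
  show "?R \<subseteq> Y_poset"
    unfolding Y_poset_def
    by (auto intro: r_into_rtrancl converse_rtrancl_into_rtrancl[where b = Y_x])
qed

lemma Partial_order_Y_poset: "Partial_order Y_poset"
  by (auto simp: Y_poset_eq Field_def partial_order_on_def preorder_on_def refl_on_def
      trans_def antisym_def)

end

theory Submission
  imports Defs Complex_Main "HOL-Combinatorics.Multiset_Permutations"
begin

text \<open>
  Let \<open>c \<ge> d\<close> be the two largest binomial coefficients \<open>n choose i\<close>. The two middle layers contain
  no chain of three sets, so they contain neither poset and give the lower bound \<open>c + d\<close>. For
  the upper bound, count pairs of a member of the family and a maximal chain through it; the number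
  of pairs divided by \<open>n!\<close> is the Lubell function, the sum of \<open>1 / (n choose |B|)\<close> over the members
  \<open>B\<close>. A family whose Lubell function is \<open>L\<close> has at most \<open>c - d + d * L\<close> members
  (\<open>card_le_lubell\<close>), which is \<open>c + d\<close> when \<open>L = 2\<close>.

  Maximal chains are permutations, and the key is a reversal. Suppose that the members strictly
  above \<open>B\<close> form a chain that does not contain the full set. If a maximal chain through \<open>B\<close> meets
  one of them, then reversing the order in which elements are added after \<open>B\<close> gives a maximal chain
  that meets none: in a list without repetitions, a nonempty proper prefix and a nonempty
  proper suffix never have comparable sets of elements. So at most half of the maximal chains through \<open>B\<close> meet a member above \<open>B\<close>. The same
  holds below \<open>B\<close>, and the two reversals can be carried out together.

  If neither the empty nor the full set belongs to the family, let \<open>B\<close> be a member with members on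
  both sides. Absence of \<open>Y\<close> and its dual makes the members above \<open>B\<close> a chain, and those below \<open>B\<close>
  too. The double reversal maps the chains on which \<open>B\<close> is neither the highest nor the lowest member
  injectively to chains on which it is the only one. By inclusion-exclusion, the number of chains
  through \<open>B\<close> is at most the number of those where it is highest plus the number of those where it
  is lowest (\<open>card_through_le_highest_plus_lowest\<close>). Every chain has at most one highest and one
  lowest member, so summing over \<open>B\<close> gives \<open>L \<le> 2\<close>.

  The Lubell function can reach 3 when the empty and the full set are both present, as for these
  two sets together with a full layer. If the empty set is present, drop both from the family. The
  members above any remaining member form a chain, because the empty set lies below it. So at most
  twice as many chains pass through \<open>B\<close> as have \<open>B\<close> as highest member, and for a maximal \<open>B\<close> the
  factor 2 is superfluous. This gives \<open>L \<le> 2\<close> with a slack of at least \<open>1 / c\<close> for every maximal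
  member (\<open>lubell_plus_maximal_le_2\<close>). One maximal member leaves room for the empty set. If the
  full set is present too, either the family is a chain and small, or there are two maximal
  members, and their slack leaves room for two sets since \<open>c < 2 * d\<close>. The case where only the full
  set is present follows by taking complements.
\<close>

section \<open>Maximal chains as permutations\<close>

text \<open>
  A permutation of the ground set encodes the maximal chain of the sets of elements of its
  prefixes.
\<close>

definition passes :: "'a list \<Rightarrow> 'a set \<Rightarrow> bool" where
  "passes \<pi> A \<longleftrightarrow> set (take (card A) \<pi>) = A"

definition through :: "'a set \<Rightarrow> 'a set \<Rightarrow> 'a list set" where
  "through U B = {\<pi> \<in> permutations_of_set U. passes \<pi> B}"

lemma finite_through [simp]: "finite (through U B)"
  by (simp add: through_def)

lemma passes_comparable:
  assumes "passes \<pi> A" "passes \<pi> B"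
  shows "A \<subseteq> B \<or> B \<subseteq> A"
  using assms unfolding passes_def
  by (metis nle_le set_take_subset_set_take)

lemma through_split:
  assumes "\<pi> \<in> through U B" "finite U"
  obtains p q where "\<pi> = p @ q" "set p = B" "set q = U - B" "distinct p" "distinct q"
    "length p = card B"
proof
  let ?p = "take (card B) \<pi>" and ?q = "drop (card B) \<pi>"
  have d: "distinct \<pi>" and s: "set \<pi> = U" and B: "set ?p = B"
    using assms by (auto simp: through_def passes_def permutations_of_set_def)
  show "\<pi> = ?p @ ?q" by simp
  show "set ?p = B" by (rule B)
  show "distinct ?p" "distinct ?q" using d by auto
  show "length ?p = card B" using B \<open>distinct ?p\<close> distinct_card by metis
  have "set ?p \<union> set ?q = U" using s by (metis append_take_drop_id set_append)
  moreover have "set ?p \<inter> set ?q = {}" using d by (simp add: set_take_disj_set_drop_if_distinct)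
  ultimately show "set ?q = U - B" using B by auto
qed

lemma append_in_through:
  assumes "set p = B" "set q = U - B" "distinct p" "distinct q" "B \<subseteq> U"
  shows "p @ q \<in> through U B"
  using assms distinct_card[of p]
  by (auto simp: through_def passes_def permutations_of_set_def)

lemma card_through:
  assumes "finite U" "B \<subseteq> U"
  shows "card (through U B) = fact (card B) * fact (card U - card B)"
proof -
  have "bij_betw (\<lambda>(p, q). p @ q)
      (permutations_of_set B \<times> permutations_of_set (U - B)) (through U B)"
  proof (rule bij_betw_imageI)
    show "inj_on (\<lambda>(p, q). p @ q) (permutations_of_set B \<times> permutations_of_set (U - B))"
      by (auto simp: inj_on_def permutations_of_set_def append_eq_append_conv dest: distinct_card)
        (metis append_eq_append_conv distinct_card)+
    show "(\<lambda>(p, q). p @ q) ` (permutations_of_set B \<times> permutations_of_set (U - B)) = through U B"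
    proof
      show "(\<lambda>(p, q). p @ q) ` (permutations_of_set B \<times> permutations_of_set (U - B)) \<subseteq> through U B"
        using assms by (auto simp: permutations_of_set_def intro!: append_in_through)
      show "through U B \<subseteq> (\<lambda>(p, q). p @ q) ` (permutations_of_set B \<times> permutations_of_set (U - B))"
      proof
        fix \<pi> assume "\<pi> \<in> through U B"
        then obtain p q where "\<pi> = p @ q" "set p = B" "set q = U - B" "distinct p" "distinct q"
          using through_split assms by metis
        then show "\<pi> \<in> (\<lambda>(p, q). p @ q) ` (permutations_of_set B \<times> permutations_of_set (U - B))"
          by (auto simp: permutations_of_set_def image_iff)
      qed
    qed
  qed
  then have "card (through U B) = card (permutations_of_set B \<times> permutations_of_set (U - B))"
    by (simp add: bij_betw_same_card)
  also have "\<dots> = fact (card B) * fact (card U - card B)"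
    using assms by (simp add: card_cartesian_product card_Diff_subset finite_subset)
  finally show ?thesis .
qed

lemma card_through_real:
  assumes "finite U" "B \<subseteq> U"
  shows "real (card (through U B)) = fact (card U) / real (card U choose card B)"
  using card_through[OF assms] binomial_fact[of "card B" "card U", where 'a = real]
    card_mono[OF assms]
  by simp

section \<open>Reversing a chain\<close>

text \<open>
  The first element of the list lies in every nonempty prefix and in no proper suffix; the last
  element separates the two sets the other way round.
\<close>

lemma prefix_not_comparable_prefix_rev:
  assumes "distinct xs" "0 < i" "i < length xs" "0 < j" "j < length xs"
  shows "\<not> set (take i xs) \<subseteq> set (take j (rev xs))"
    and "\<not> set (take j (rev xs)) \<subseteq> set (take i xs)"
proof -
  have ne: "xs \<noteq> []" using assms by auto
  obtain y ys where y: "xs = y # ys" using ne by (cases xs) auto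
  have "y \<notin> set (take j (rev xs))"
    using assms y by (auto dest: in_set_takeD)
  moreover have "y \<in> set (take i xs)"
    using assms y by (cases i) auto
  ultimately show "\<not> set (take i xs) \<subseteq> set (take j (rev xs))" by auto
  obtain z zs where z: "xs = zs @ [z]" using ne by (cases xs rule: rev_cases) auto
  have "z \<notin> set (take i xs)"
    using assms z by (auto dest: in_set_takeD)
  moreover have "z \<in> set (take j (rev xs))"
    using assms z by (cases j) auto
  ultimately show "\<not> set (take j (rev xs)) \<subseteq> set (take i xs)" by auto
qed

text \<open>
  In the next two lemmas \<open>p\<close> lists \<open>B\<close>. If a family is a chain below (or above) \<open>B\<close>, its
  members there are pairwise comparable, so \<open>A\<close> and \<open>C\<close> cannot both belong to it: reversing a
  part of a permutation that meets the family there yields one that misses it.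
\<close>

lemma reversal_misses_below:
  assumes "distinct p" "length p = card B" "set p = B" "passes (p @ q) A" "passes (rev p @ q') C"
    and "A \<subset> B" "C \<subset> B" "A \<noteq> {}" "C \<noteq> {}"
  shows "\<not> A \<subseteq> C" "\<not> C \<subseteq> A"
proof -
  have fin: "finite B" using assms by auto
  have lt: "card A < length p" "card C < length p"
    using assms psubset_card_mono[OF fin] by auto
  have A: "set (take (card A) p) = A" and C: "set (take (card C) (rev p)) = C"
    using assms lt by (auto simp: passes_def)
  have pos: "card A > 0" "card C > 0"
    using assms fin by (metis card_gt_0_iff finite_subset psubset_imp_subset)+
  show "\<not> A \<subseteq> C" "\<not> C \<subseteq> A"
    using prefix_not_comparable_prefix_rev[OF assms(1) pos(1) lt(1) pos(2) lt(2)] A C by auto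
qed

lemma reversal_misses_above:
  assumes "distinct q" "set q = U - B" "length p = card B" "set p = B" "length p' = card B" "set p' = B"
    and "passes (p @ q) A" "passes (p' @ rev q) C"
    and "B \<subset> A" "B \<subset> C" "A \<subset> U" "C \<subset> U" "finite U"
  shows "\<not> A \<subseteq> C" "\<not> C \<subseteq> A"
proof -
  have fin: "finite A" "finite C" using assms finite_subset by auto
  have lenq: "length q = card U - card B"
    using assms distinct_card[of q] card_Diff_subset[of B U] finite_subset[of B U] by auto
  let ?a = "card A - card B" and ?c = "card C - card B"
  have pos: "0 < ?a" "0 < ?c"
    using assms fin psubset_card_mono by auto
  have lt: "?a < length q" "?c < length q"
    using lenq pos psubset_card_mono[of U A] psubset_card_mono[of U C] assms by auto
  have "set p \<union> set (take ?a q) = A" "set p' \<union> set (take ?c (rev q)) = C"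
    using assms(3,5,7,8) pos unfolding passes_def by simp_all
  then have A: "B \<union> set (take ?a q) = A" and C: "B \<union> set (take ?c (rev q)) = C"
    unfolding assms(4,6) .
  have "set (take ?a q) \<inter> B = {}" "set (take ?c (rev q)) \<inter> B = {}"
    using assms(2) set_take_subset[of ?a q] set_take_subset[of ?c "rev q"] by auto
  then have AB: "set (take ?a q) = A - B" and CB: "set (take ?c (rev q)) = C - B"
    using A C by blast+
  then show "\<not> A \<subseteq> C" "\<not> C \<subseteq> A"
    using prefix_not_comparable_prefix_rev[OF assms(1) pos(1) lt(1) pos(2) lt(2)]
    unfolding AB CB by blast+
qed

section \<open>Highest and lowest members of a family on a chain\<close>

definition through_highest :: "'a set \<Rightarrow> 'a set set \<Rightarrow> 'a set \<Rightarrow> 'a list set" where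
  "through_highest U F B = {\<pi> \<in> through U B. \<forall>C\<in>F. B \<subset> C \<longrightarrow> \<not> passes \<pi> C}"

definition through_lowest :: "'a set \<Rightarrow> 'a set set \<Rightarrow> 'a set \<Rightarrow> 'a list set" where
  "through_lowest U F B = {\<pi> \<in> through U B. \<forall>C\<in>F. C \<subset> B \<longrightarrow> \<not> passes \<pi> C}"

lemma finite_through_highest [simp]: "finite (through_highest U F B)"
  and finite_through_lowest [simp]: "finite (through_lowest U F B)"
  by (simp_all add: through_highest_def through_lowest_def)

text \<open>
  The sets of chains counted are disjoint, since members on one chain are comparable and only one
  of them is highest.
\<close>

lemma sum_card_through_highest:
  assumes "finite U" "finite F"
  shows "(\<Sum>B\<in>F. card (through_highest U F B)) \<le> fact (card U)"
proof -
  have "(\<Sum>B\<in>F. card (through_highest U F B)) = card (\<Union>B\<in>F. through_highest U F B)"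
    using assms
    by (intro card_UN_disjoint[symmetric])
      (auto simp: through_highest_def through_def dest: passes_comparable)
  also have "\<dots> \<le> card (permutations_of_set U)"
    by (intro card_mono) (auto simp: through_highest_def through_def)
  finally show ?thesis using assms by simp
qed

lemma sum_card_through_lowest:
  assumes "finite U" "finite F"
  shows "(\<Sum>B\<in>F. card (through_lowest U F B)) \<le> fact (card U)"
proof -
  have "(\<Sum>B\<in>F. card (through_lowest U F B)) = card (\<Union>B\<in>F. through_lowest U F B)"
    using assms
    by (intro card_UN_disjoint[symmetric])
      (auto simp: through_lowest_def through_def dest: passes_comparable)
  also have "\<dots> \<le> card (permutations_of_set U)"
    by (intro card_mono) (auto simp: through_lowest_def through_def)
  finally show ?thesis using assms by simp
qed

text \<open>
  Reversing the part above \<open>B\<close> is an involution on the chains through \<open>B\<close>, and it maps those that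
  meet a member above \<open>B\<close> to chains that meet none.
\<close>

lemma card_through_le_twice_highest:
  assumes U: "finite U" "F \<subseteq> Pow U" "U \<notin> F" and B: "B \<in> F"
    and chain: "chain\<^sub>\<subseteq> {C \<in> F. B \<subset> C}"
  shows "card (through U B) \<le> 2 * card (through_highest U F B)"
proof -
  let ?T = "through_highest U F B" and ?S = "through U B"
  let ?r = "\<lambda>\<pi>. take (card B) \<pi> @ rev (drop (card B) \<pi>)"
  have "card (?S - ?T) \<le> card ?T"
  proof (rule card_inj_on_le)
    show "inj_on ?r (?S - ?T)"
      by (rule inj_on_inverseI[where g = ?r]) 
         (auto elim!: through_split[OF _ U(1)])
    show "?r ` (?S - ?T) \<subseteq> ?T"
    proof safe
      fix \<pi> assume \<pi>: "\<pi> \<in> ?S" "\<pi> \<notin> ?T"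
      obtain p q where pq: "\<pi> = p @ q" "set p = B" "set q = U - B" "distinct p" "distinct q"
          "length p = card B"
        using through_split[OF \<pi>(1) U(1)] .
      obtain A where A: "A \<in> F" "B \<subset> A" "passes \<pi> A"
        using \<pi> by (auto simp: through_highest_def)
      have "p @ rev q \<in> ?S"
        using pq U B by (intro append_in_through) auto
      moreover have "\<not> passes (p @ rev q) C" if "C \<in> F" "B \<subset> C" for C
      proof
        assume "passes (p @ rev q) C"
        then have "\<not> A \<subseteq> C" "\<not> C \<subseteq> A"
          using reversal_misses_above[OF pq(5,3,6,2,6,2), of A C] A U that pq(1) by auto
        then show False using chain A that by (auto simp: chain_subset_def)
      qed
      ultimately show "?r \<pi> \<in> ?T" using pq by (auto simp: through_highest_def)
    qed
  qed simp
  moreover have "card ?S = card ?T + card (?S - ?T)"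
    using card_Int_Diff[of ?S ?T] by (simp add: through_highest_def Int_absorb1)
  ultimately show ?thesis by simp
qed

text \<open>
  Let \<open>T\<close> and \<open>L\<close> be the sets of chains on which \<open>B\<close> is highest and lowest. Reversing both parts of
  a chain outside \<open>T \<union> L\<close> clears both sides of \<open>B\<close> and lands in \<open>T \<inter> L\<close>. So there are at most
  \<open>|T \<union> L| + |T \<inter> L| = |T| + |L|\<close> chains through \<open>B\<close>. The chain conditions on \<open>F\<close> are
  required only if \<open>B\<close> has members on the other side, which is what the absence of \<open>Y\<close> and its
  dual provides; otherwise every chain through \<open>B\<close> is in \<open>T\<close> or in \<open>L\<close>.
\<close>

lemma card_through_le_highest_plus_lowest:
  assumes U: "finite U" "F \<subseteq> Pow U" "U \<notin> F" "{} \<notin> F" and B: "B \<in> F"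
    and above: "\<exists>A\<in>F. A \<subset> B \<Longrightarrow> chain\<^sub>\<subseteq> {C \<in> F. B \<subset> C}"
    and below: "\<exists>A\<in>F. B \<subset> A \<Longrightarrow> chain\<^sub>\<subseteq> {C \<in> F. C \<subset> B}"
  shows "card (through U B) \<le> card (through_highest U F B) + card (through_lowest U F B)"
proof -
  let ?T = "through_highest U F B" and ?L = "through_lowest U F B" and ?S = "through U B"
  let ?r = "\<lambda>\<pi>. rev (take (card B) \<pi>) @ rev (drop (card B) \<pi>)"
  have "card (?S - (?T \<union> ?L)) \<le> card (?T \<inter> ?L)"
  proof (rule card_inj_on_le)
    show "inj_on ?r (?S - (?T \<union> ?L))"
      by (rule inj_on_inverseI[where g = ?r]) 
         (auto elim!: through_split[OF _ U(1)])
    show "?r ` (?S - (?T \<union> ?L)) \<subseteq> ?T \<inter> ?L"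
    proof (rule image_subsetI)
      fix \<pi> assume "\<pi> \<in> ?S - (?T \<union> ?L)"
      then have \<pi>: "\<pi> \<in> ?S" "\<pi> \<notin> ?T" "\<pi> \<notin> ?L" by auto
      obtain p q where pq: "\<pi> = p @ q" "set p = B" "set q = U - B" "distinct p" "distinct q"
          "length p = card B"
        using through_split[OF \<pi>(1) U(1)] .
      obtain A where A: "A \<in> F" "B \<subset> A" "passes \<pi> A"
        using \<pi> by (auto simp: through_highest_def)
      obtain D where D: "D \<in> F" "D \<subset> B" "passes \<pi> D"
        using \<pi> by (auto simp: through_lowest_def)
      have "rev p @ rev q \<in> ?S"
        using pq U B by (intro append_in_through) auto
      moreover have "\<not> passes (rev p @ rev q) C" if "C \<in> F" "B \<subset> C" for C
      proof
        assume "passes (rev p @ rev q) C"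
        then have "\<not> A \<subseteq> C" "\<not> C \<subseteq> A"
          using reversal_misses_above[OF pq(5,3,6,2), of "rev p" A C] A U that pq by auto
        then show False using above A D that by (auto simp: chain_subset_def)
      qed
      moreover have "\<not> passes (rev p @ rev q) C" if "C \<in> F" "C \<subset> B" for C
      proof
        assume "passes (rev p @ rev q) C"
        then have "\<not> D \<subseteq> C" "\<not> C \<subseteq> D"
          using reversal_misses_below[OF pq(4,6,2), of q D "rev q" C] D U that pq by auto
        then show False using below A D that by (auto simp: chain_subset_def)
      qed
      ultimately show "?r \<pi> \<in> ?T \<inter> ?L" using pq
        by (auto simp: through_highest_def through_lowest_def)
    qed
  qed simp
  moreover have "card ?S = card (?T \<union> ?L) + card (?S - (?T \<union> ?L))"
  proof -
    have "?S \<inter> (?T \<union> ?L) = ?T \<union> ?L"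
      by (auto simp: through_highest_def through_lowest_def)
    then show ?thesis using card_Int_Diff[of ?S "?T \<union> ?L"] by simp
  qed
  moreover have "card ?T + card ?L = card (?T \<union> ?L) + card (?T \<inter> ?L)"
    by (rule card_Un_Int) auto
  ultimately show ?thesis by simp
qed

section \<open>Bounds on the Lubell function\<close>

definition lubell :: "nat \<Rightarrow> 'a set set \<Rightarrow> real" where
  "lubell n F = (\<Sum>B\<in>F. 1 / real (n choose card B))"

lemma lubell_eq_sum_through:
  assumes "finite U" "F \<subseteq> Pow U"
  shows "fact (card U) * lubell (card U) F = (\<Sum>B\<in>F. real (card (through U B)))"
  unfolding lubell_def sum_distrib_left
  using assms by (intro sum.cong) (auto simp: card_through_real)

text \<open>
  Absence of an induced \<open>Y\<close>: an element \<open>B\<close> in the role of \<open>x\<close>, with some \<open>w\<close> below it, has no two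
  incomparable elements above it.
\<close>

definition Y_free :: "'a set set \<Rightarrow> bool" where
  "Y_free F \<longleftrightarrow> (\<forall>B\<in>F. (\<exists>A\<in>F. A \<subset> B) \<longrightarrow> chain\<^sub>\<subseteq> {C \<in> F. B \<subset> C})"

definition Y_dual_free :: "'a set set \<Rightarrow> bool" where
  "Y_dual_free F \<longleftrightarrow> (\<forall>B\<in>F. (\<exists>A\<in>F. B \<subset> A) \<longrightarrow> chain\<^sub>\<subseteq> {C \<in> F. C \<subset> B})"

lemma lubell_le_2:
  assumes U: "finite U" "F \<subseteq> Pow U" "U \<notin> F" "{} \<notin> F"
    and free: "Y_free F" "Y_dual_free F"
  shows "lubell (card U) F \<le> 2"
proof -
  have fin: "finite F" using U by (meson finite_Pow_iff finite_subset)
  have "(\<Sum>B\<in>F. card (through U B))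
      \<le> (\<Sum>B\<in>F. card (through_highest U F B) + card (through_lowest U F B))"
    using free unfolding Y_free_def Y_dual_free_def
    by (intro sum_mono card_through_le_highest_plus_lowest U) auto
  also have "\<dots> \<le> fact (card U) + fact (card U)"
    unfolding sum.distrib
    using sum_card_through_highest[OF U(1) fin] sum_card_through_lowest[OF U(1) fin] by (rule add_mono)
  finally have "real (\<Sum>B\<in>F. card (through U B)) \<le> real (fact (card U) + fact (card U))"
    by (rule of_nat_mono)
  then have "fact (card U) * lubell (card U) F \<le> fact (card U) * 2"
    using lubell_eq_sum_through[OF U(1,2)] by simp
  then show ?thesis by simp
qed

text \<open>
  A maximal member is highest on each chain through it, so it satisfies the bound by twice the
  number of chains on which it is highest with its own number of chains to spare. The spare chains
  of the members in \<open>M\<close> are the second summand.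
\<close>

lemma lubell_plus_maximal_le_2:
  assumes U: "finite U" "F \<subseteq> Pow U" "U \<notin> F"
    and chain: "\<And>B. B \<in> F \<Longrightarrow> chain\<^sub>\<subseteq> {C \<in> F. B \<subset> C}"
    and M: "M \<subseteq> F" "\<And>B C. B \<in> M \<Longrightarrow> C \<in> F \<Longrightarrow> \<not> B \<subset> C"
  shows "lubell (card U) F + lubell (card U) M \<le> 2"
proof -
  have fin: "finite F" using U by (meson finite_Pow_iff finite_subset)
  let ?s = "\<lambda>B. card (through U B)" and ?t = "\<lambda>B. card (through_highest U F B)"
  have max: "?s B = ?t B" if "B \<in> M" for B
    using M(2)[OF that] by (intro arg_cong[where f = card]) (auto simp: through_highest_def)
  have "sum ?s F + sum ?s M = (\<Sum>B\<in>F. ?s B + (if B \<in> M then ?s B else 0))"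
    using fin M(1) by (simp add: sum.distrib sum.inter_restrict[symmetric] Int_absorb1)
  also have "\<dots> \<le> (\<Sum>B\<in>F. 2 * ?t B)"
    using card_through_le_twice_highest[OF U _ chain] max by (intro sum_mono) auto
  also have "\<dots> \<le> 2 * fact (card U)"
    unfolding sum_distrib_left[symmetric]
    using sum_card_through_highest[OF U(1) fin] by simp
  finally have "real (sum ?s F + sum ?s M) \<le> real (2 * fact (card U))"
    by (rule of_nat_mono)
  then have "fact (card U) * (lubell (card U) F + lubell (card U) M) \<le> fact (card U) * 2"
    using lubell_eq_sum_through[OF U(1,2)] lubell_eq_sum_through[OF U(1), of M] U(2) M(1)
    by (simp add: distrib_left)
  then show ?thesis by simp
qed

section \<open>From the Lubell function to cardinalities\<close>

lemma binomial_le_next_to_middle: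
  assumes "i \<noteq> n div 2"
  shows "n choose i \<le> n choose (n div 2 + 1)"
proof (cases "i \<le> n div 2")
  case True
  have "n choose i \<le> n choose (n - (n div 2 + 1))"
    using True assms by (intro binomial_mono) auto
  also have "\<dots> = n choose (n div 2 + 1)"
  proof (cases "n = 0")
    case False
    then show ?thesis by (intro binomial_symmetric[symmetric]) auto
  qed (use True assms in auto)
  finally show ?thesis .
next
  case False
  show ?thesis
  proof (cases "i \<le> n")
    case True
    then show ?thesis using False by (intro binomial_antimono) auto
  qed (simp add: binomial_eq_0)
qed

text \<open>
  A member of the layer \<open>n div 2\<close> contributes exactly \<open>1 / c\<close> to the Lubell function, and every
  other member at least \<open>1 / d\<close>. Weighting by \<open>d\<close> counts all but the middle layer in full; there
  each of at most \<open>c\<close> members is short by \<open>1 - d / c\<close>, which amounts to \<open>c - d\<close> in total.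
\<close>

lemma card_le_lubell:
  assumes "finite U" "F \<subseteq> Pow U" and n: "card U = n"
  defines "c \<equiv> real (n choose (n div 2))" and "d \<equiv> real (n choose (n div 2 + 1))"
  shows "real (card F) \<le> c - d + d * lubell n F"
proof -
  have fin: "finite F" using assms by (meson finite_Pow_iff finite_subset)
  have cd: "d \<le> c" unfolding c_def d_def using binomial_maximum[of n "n div 2 + 1"] by simp
  have c0: "c > 0" unfolding c_def by simp
  let ?M = "{B \<in> F. card B = n div 2}"
  have pw: "1 \<le> d * (1 / real (n choose card B)) + (if card B = n div 2 then (c - d) / c else 0)"
    if "B \<in> F" for B
  proof (cases "card B = n div 2")
    case True
    then show ?thesis using c0 unfolding c_def by (simp add: field_simps)
  next
    case False
    have "card B \<le> n" using that assms by (metis PowD card_mono subsetD)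
    then have "n choose card B > 0" by simp
    moreover have "real (n choose card B) \<le> d"
      unfolding d_def using binomial_le_next_to_middle[OF False] by simp
    ultimately show ?thesis using False by (simp add: field_simps)
  qed
  have "real (card F) = (\<Sum>B\<in>F. 1)" by simp
  also have "\<dots> \<le> (\<Sum>B\<in>F. d * (1 / real (n choose card B))
      + (if card B = n div 2 then (c - d) / c else 0))"
    by (rule sum_mono) (rule pw)
  also have "\<dots> = d * lubell n F + real (card ?M) * ((c - d) / c)"
    using fin by (simp add: sum.distrib lubell_def sum_distrib_left sum.If_cases Int_def)
  also have "\<dots> \<le> d * lubell n F + c * ((c - d) / c)"
  proof -
    have "card ?M \<le> card {B. B \<subseteq> U \<and> card B = n div 2}"
      using assms by (intro card_mono) auto
    then have "card ?M \<le> n choose (n div 2)"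
      using n_subsets[OF assms(1)] n by simp
    then have "real (card ?M) \<le> c" unfolding c_def by simp
    then show ?thesis using cd c0 by (intro add_left_mono mult_right_mono) auto
  qed
  also have "\<dots> = c - d + d * lubell n F" using c0 by simp
  finally show ?thesis .
qed

text \<open>
  For \<open>n = 2\<close> the two sides agree, and correspondingly the whole power set of a two-element set,
  with \<open>4 > 2 + 1\<close> members, contains neither \<open>Y\<close> nor its dual.
\<close>

lemma middle_binomial_lt_twice_next:
  assumes "n \<ge> 3"
  shows "n choose (n div 2) < 2 * (n choose (n div 2 + 1))"
proof -
  define m where "m = n div 2"
  have absorb: "(n choose Suc m) * Suc m = (n choose m) * (n - m)"
    by (metis binomial_absorb_comp binomial_absorption mult.commute)
  have "Suc m < 2 * (n - m)" using assms unfolding m_def by linarith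
  moreover have "n choose m > 0" unfolding m_def by simp
  ultimately have "(n choose m) * Suc m < (n choose m) * (2 * (n - m))"
    by (rule mult_strict_left_mono)
  also have "\<dots> = 2 * (n choose Suc m) * Suc m" using absorb by simp
  finally show ?thesis unfolding mult_less_cancel2 m_def by simp
qed

section \<open>The upper bound\<close>

lemma obtain_maximal:
  assumes "finite F" "A \<in> F"
  obtains B where "B \<in> F" "A \<subseteq> B" "\<And>C. C \<in> F \<Longrightarrow> \<not> B \<subset> C"
  using finite_has_maximal2[OF assms] by (metis psubset_eq)

text \<open>
  The bound for \<open>F\<close> without the empty and the full set has to be improved by as many sets as were
  dropped; the maximal members of the rest pay for this.
\<close>

lemma card_le_with_empty:
  assumes U: "finite U" "F \<subseteq> Pow U" and n: "card U = n" "n \<ge> 3"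
    and free: "Y_free F" "Y_dual_free F" and e: "{} \<in> F"
  shows "card F \<le> (n choose (n div 2)) + (n choose (n div 2 + 1))"
proof -
  define c d where "c = n choose (n div 2)" and "d = n choose (n div 2 + 1)"
  have finF: "finite F" using U by (meson finite_Pow_iff finite_subset)
  have d0: "d > 0" unfolding d_def using n by simp
  have cn: "n \<le> c" unfolding c_def using binomial_maximum[of n 1] by simp
  define G where "G = F - {{}, U}"
  have G: "G \<subseteq> Pow U" "finite G" "U \<notin> G" using U finF by (auto simp: G_def)
  have chain: "chain\<^sub>\<subseteq> {C \<in> G. B \<subset> C}" if "B \<in> G" for B
  proof -
    have "chain\<^sub>\<subseteq> {C \<in> F. B \<subset> C}"
      using free(1) e that unfolding Y_free_def G_def by blast
    then show ?thesis by (auto simp: chain_subset_def G_def)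
  qed
  have pbound: "1 / real c \<le> 1 / real (n choose card B)" if "B \<in> G" for B
  proof -
    have "card B \<le> n" using that G n U(1) by (metis PowD card_mono subsetD)
    then have "n choose card B > 0" by simp
    then show ?thesis using binomial_maximum[of n "card B"] unfolding c_def
      by (intro divide_left_mono) auto
  qed
  \<comment> \<open>Every maximal member of \<open>G\<close> lowers the bound \<open>c + d\<close> by at least \<open>d / c\<close>.\<close>
  have slack: "real (card G) + real (card M) * (real d / real c) \<le> real (c + d)"
    if M: "M \<subseteq> G" "\<And>B C. B \<in> M \<Longrightarrow> C \<in> G \<Longrightarrow> \<not> B \<subset> C" for M
  proof -
    have "real (card M) * (1 / real c) = (\<Sum>B\<in>M. 1 / real c)" by simp
    also have "\<dots> \<le> lubell n M"
      unfolding lubell_def using pbound M(1) by (intro sum_mono) auto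
    finally have "real (card M) * (1 / real c) + lubell n G \<le> 2"
      using lubell_plus_maximal_le_2[OF U(1) G(1,3) chain M] n by simp
    then have "real d * (real (card M) * (1 / real c) + lubell n G) \<le> real d * 2"
      by (intro mult_left_mono) auto
    then show ?thesis using card_le_lubell[OF U(1) G(1) n(1)] unfolding c_def d_def
      by (simp add: algebra_simps)
  qed
  have cardF: "card F \<le> card G + (if U \<in> F then 2 else 1)"
  proof -
    have "F \<subseteq> G \<union> (if U \<in> F then {{}, U} else {{}})" by (auto simp: G_def)
    then have "card F \<le> card (G \<union> (if U \<in> F then {{}, U} else {{}}))"
      using G by (intro card_mono) auto
    also have "\<dots> \<le> card G + card (if U \<in> F then {{}, U} else {{}})" by (rule card_Un_le)
    also have "\<dots> \<le> card G + (if U \<in> F then 2 else 1)"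
      by (auto simp: card_insert_if)
    finally show ?thesis .
  qed
  show ?thesis
  proof (cases "chain\<^sub>\<subseteq> F")
    case True
    \<comment> \<open>A chain has at most \<open>n + 1\<close> members, and already \<open>c \<ge> n\<close> and \<open>d \<ge> 1\<close>.\<close>
    have "inj_on card F"
    proof (rule inj_onI)
      fix A B assume AB: "A \<in> F" "B \<in> F" "card A = card B"
      have "finite A" "finite B" using AB U finite_subset by blast+
      then show "A = B" using True AB by (metis card_subset_eq chain_subset_def)
    qed
    then have "card F \<le> card {0..n}"
      using U n by (intro card_inj_on_le[of card]) (auto simp: card_mono)
    then have "card F \<le> c + d" using cn d0 by simp
    then show ?thesis unfolding c_def d_def .
  next
    case False
    then obtain A B where AB: "A \<in> F" "B \<in> F" "\<not> A \<subseteq> B" "\<not> B \<subseteq> A"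
      by (auto simp: chain_subset_def)
    then have AG: "A \<in> G" "B \<in> G" using U by (auto simp: G_def)
    obtain A' where A': "A' \<in> G" "A \<subseteq> A'" "\<And>C. C \<in> G \<Longrightarrow> \<not> A' \<subset> C"
      using obtain_maximal[OF G(2) AG(1)] by blast
    obtain B' where B': "B' \<in> G" "B \<subseteq> B'" "\<And>C. C \<in> G \<Longrightarrow> \<not> B' \<subset> C"
      using obtain_maximal[OF G(2) AG(2)] by blast
    show ?thesis
    proof (cases "U \<in> F")
      case True
      \<comment> \<open>A common maximal member above \<open>A\<close> and \<open>B\<close> would form a dual \<open>Y\<close> with them and \<open>U\<close>.\<close>
      have ne: "A' \<noteq> B'"
      proof
        assume eq: "A' = B'"
        have "A' \<in> F" "A' \<subset> U" using A'(1) U by (auto simp: G_def)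
        then have "chain\<^sub>\<subseteq> {C \<in> F. C \<subset> A'}"
          using free(2) True unfolding Y_dual_free_def by blast
        moreover have "A \<subset> A'" "B \<subset> A'" using AB A'(2) B'(2) eq by auto
        ultimately show False using AB by (auto simp: chain_subset_def)
      qed
      have "real (card G) + real (card {A', B'}) * (real d / real c) \<le> real (c + d)"
        using A' B' by (intro slack) auto
      moreover have "card {A', B'} = 2" using ne by simp
      moreover have "2 * (real d / real c) > 1"
      proof -
        have "real c < 2 * real d"
          using middle_binomial_lt_twice_next[OF n(2)] unfolding c_def d_def by linarith
        moreover have "real c > 0" using cn n(2) by simp
        ultimately show ?thesis by simp
      qed
      \<comment> \<open>Strictness, by integrality, is what makes room for the second dropped set.\<close>
      ultimately have "real (card G) + 1 < real (c + d)" by simp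
      then have "card G + 2 \<le> c + d" by linarith
      then show ?thesis using cardF True unfolding c_def d_def by simp
    next
      case False
      have "real (card G) + real (card {A'}) * (real d / real c) \<le> real (c + d)"
        using A' by (intro slack) auto
      moreover have "real d / real c > 0" using d0 cn n(2) by simp
      ultimately have "real (card G) < real (c + d)" by simp
      then have "card G + 1 \<le> c + d" by linarith
      then show ?thesis using cardF False unfolding c_def d_def by simp
    qed
  qed
qed

lemma chain_subset_antimono:
  assumes "chain\<^sub>\<subseteq> S" "T \<subseteq> S"
  shows "chain\<^sub>\<subseteq> T"
  using assms unfolding chain_subset_def by blast

lemma Y_free_complements:
  assumes "F \<subseteq> Pow U" "Y_dual_free F"
  shows "Y_free ((-) U ` F)"
  unfolding Y_free_def
proof (intro ballI impI)
  fix B assume "B \<in> (-) U ` F" and ex: "\<exists>A\<in>(-) U ` F. A \<subset> B"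
  then obtain B' where B': "B' \<in> F" "B = U - B'" by blast
  obtain A' where A': "A' \<in> F" "U - A' \<subset> U - B'" using ex unfolding B'(2) by blast
  have reverse: "D \<subset> C" if "C \<in> F" "D \<in> F" "U - C \<subset> U - D" for C D
  proof -
    have "C \<subseteq> U" "D \<subseteq> U" using assms(1) that(1,2) by auto
    then show ?thesis using that(3) by blast
  qed
  have "B' \<subset> A'" using reverse A' B'(1) by blast
  then have "chain\<^sub>\<subseteq> {C \<in> F. C \<subset> B'}"
    using assms(2) B'(1) A'(1) unfolding Y_dual_free_def by blast
  then have "chain\<^sub>\<subseteq> ((-) U ` {C \<in> F. C \<subset> B'})"
    unfolding chain_subset_def by blast
  moreover have "{C \<in> (-) U ` F. B \<subset> C} \<subseteq> (-) U ` {C \<in> F. C \<subset> B'}"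
  proof
    fix D assume "D \<in> {C \<in> (-) U ` F. B \<subset> C}"
    then obtain C where "C \<in> F" "D = U - C" "U - B' \<subset> U - C" unfolding B'(2) by blast
    then show "D \<in> (-) U ` {C \<in> F. C \<subset> B'}" using reverse B'(1) by blast
  qed
  ultimately show "chain\<^sub>\<subseteq> {C \<in> (-) U ` F. B \<subset> C}"
    by (rule chain_subset_antimono)
qed

lemma Y_dual_free_complements:
  assumes "F \<subseteq> Pow U" "Y_free F"
  shows "Y_dual_free ((-) U ` F)"
  unfolding Y_dual_free_def
proof (intro ballI impI)
  fix B assume "B \<in> (-) U ` F" and ex: "\<exists>A\<in>(-) U ` F. B \<subset> A"
  then obtain B' where B': "B' \<in> F" "B = U - B'" by blast
  obtain A' where A': "A' \<in> F" "U - B' \<subset> U - A'" using ex unfolding B'(2) by blast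
  have reverse: "D \<subset> C" if "C \<in> F" "D \<in> F" "U - C \<subset> U - D" for C D
  proof -
    have "C \<subseteq> U" "D \<subseteq> U" using assms(1) that(1,2) by auto
    then show ?thesis using that(3) by blast
  qed
  have "A' \<subset> B'" using reverse A' B'(1) by blast
  then have "chain\<^sub>\<subseteq> {C \<in> F. B' \<subset> C}"
    using assms(2) B'(1) A'(1) unfolding Y_free_def by blast
  then have "chain\<^sub>\<subseteq> ((-) U ` {C \<in> F. B' \<subset> C})"
    unfolding chain_subset_def by blast
  moreover have "{C \<in> (-) U ` F. C \<subset> B} \<subseteq> (-) U ` {C \<in> F. B' \<subset> C}"
  proof
    fix D assume "D \<in> {C \<in> (-) U ` F. C \<subset> B}"
    then obtain C where "C \<in> F" "D = U - C" "U - C \<subset> U - B'" unfolding B'(2) by blast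
    then show "D \<in> (-) U ` {C \<in> F. B' \<subset> C}" using reverse B'(1) by blast
  qed
  ultimately show "chain\<^sub>\<subseteq> {C \<in> (-) U ` F. C \<subset> B}"
    by (rule chain_subset_antimono)
qed

lemma card_le_two_middle_layers:
  assumes U: "finite U" "F \<subseteq> Pow U" and n: "card U = n" "n \<ge> 3"
    and free: "Y_free F" "Y_dual_free F"
  shows "card F \<le> (n choose (n div 2)) + (n choose (n div 2 + 1))"
proof -
  consider "{} \<in> F" | "U \<in> F" | "{} \<notin> F" "U \<notin> F" by blast
  then show ?thesis
  proof cases
    case 1
    then show ?thesis using card_le_with_empty assms by blast
  next
    case 2
    have "inj_on ((-) U) F" using U(2) by (intro inj_onI) (metis PowD double_diff subsetD subset_refl)
    then have "card F = card ((-) U ` F)" by (simp add: card_image)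
    also have "\<dots> \<le> (n choose (n div 2)) + (n choose (n div 2 + 1))"
      using 2 Y_free_complements[OF U(2) free(2)] Y_dual_free_complements[OF U(2) free(1)]
      by (intro card_le_with_empty[OF U(1) _ n]) auto
    finally show ?thesis .
  next
    case 3
    let ?c = "real (n choose (n div 2))" and ?d = "real (n choose (n div 2 + 1))"
    have "real (card F) \<le> ?c - ?d + ?d * lubell n F"
      by (rule card_le_lubell[OF U n(1)])
    also have "\<dots> \<le> ?c - ?d + ?d * 2"
      using lubell_le_2[OF U 3(2,1) free] n(1) by (intro add_left_mono mult_left_mono) auto
    finally show ?thesis by linarith
  qed
qed

section \<open>Induced copies of Y and its dual\<close>

lemma Y_free_if_not_induced:
  assumes "\<not> induced_subposet Y_poset (inclusion_poset F)"
  shows "Y_free F"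
proof (rule ccontr)
  assume "\<not> Y_free F"
  then obtain A B C D where *: "A \<in> F" "B \<in> F" "C \<in> F" "D \<in> F" "A \<subset> B" "B \<subset> C" "B \<subset> D"
      "\<not> C \<subseteq> D" "\<not> D \<subseteq> C"
    unfolding Y_free_def chain_subset_def by blast
  let ?f = "case_Y_elem A B C D"
  have "inj ?f" using * by (auto simp: inj_def split: Y_elem.splits)
  moreover have "range ?f \<subseteq> F" using * by (auto split: Y_elem.splits)
  moreover have "(x, y) \<in> Y_poset \<longleftrightarrow> (?f x, ?f y) \<in> inclusion_poset F" for x y
    using * by (cases x; cases y) (auto simp: Y_poset_eq inclusion_poset_def relation_of_def)
  ultimately have "induced_subposet Y_poset (inclusion_poset F)"
    unfolding induced_subposet_def by auto
  then show False using assms by simp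
qed

lemma Y_dual_free_if_not_induced:
  assumes "\<not> induced_subposet Y_dual (inclusion_poset F)"
  shows "Y_dual_free F"
proof (rule ccontr)
  assume "\<not> Y_dual_free F"
  then obtain A B C D where *: "A \<in> F" "B \<in> F" "C \<in> F" "D \<in> F" "B \<subset> A" "C \<subset> B" "D \<subset> B"
      "\<not> C \<subseteq> D" "\<not> D \<subseteq> C"
    unfolding Y_dual_free_def chain_subset_def by blast
  let ?f = "case_Y_elem A B C D"
  have "inj ?f" using * by (auto simp: inj_def split: Y_elem.splits)
  moreover have "range ?f \<subseteq> F" using * by (auto split: Y_elem.splits)
  moreover have "(x, y) \<in> Y_dual \<longleftrightarrow> (?f x, ?f y) \<in> inclusion_poset F" for x y
    using * by (cases x; cases y) (auto simp: Y_poset_eq inclusion_poset_def relation_of_def)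
  ultimately have "induced_subposet Y_dual (inclusion_poset F)"
    unfolding induced_subposet_def by auto
  then show False using assms by simp
qed

lemma chain_of_three_if_induced:
  assumes "induced_subposet Y_poset (inclusion_poset F) \<or> induced_subposet Y_dual (inclusion_poset F)"
  obtains A B C where "A \<in> F" "B \<in> F" "C \<in> F" "A \<subset> B" "B \<subset> C"
proof -
  from assms show ?thesis
  proof
    assume "induced_subposet Y_poset (inclusion_poset F)"
    then obtain f where f: "inj f" "range f \<subseteq> F"
        "\<And>x y. (x, y) \<in> Y_poset \<longleftrightarrow> (f x, f y) \<in> inclusion_poset F"
      unfolding induced_subposet_def by auto
    have "f Y_w \<noteq> f Y_x" "f Y_x \<noteq> f Y_y" using f(1) by (auto dest: injD)
    moreover have "f Y_w \<subseteq> f Y_x" "f Y_x \<subseteq> f Y_y"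
      using f(3)[of Y_w Y_x] f(3)[of Y_x Y_y]
      by (auto simp: Y_poset_eq inclusion_poset_def relation_of_def)
    moreover have "f Y_w \<in> F" "f Y_x \<in> F" "f Y_y \<in> F" using f(2) by blast+
    ultimately show ?thesis using that[of "f Y_w" "f Y_x" "f Y_y"] by (simp add: psubset_eq)
  next
    assume "induced_subposet Y_dual (inclusion_poset F)"
    then obtain f where f: "inj f" "range f \<subseteq> F"
        "\<And>x y. (x, y) \<in> Y_dual \<longleftrightarrow> (f x, f y) \<in> inclusion_poset F"
      unfolding induced_subposet_def by auto
    have "f Y_w \<noteq> f Y_x" "f Y_x \<noteq> f Y_y" using f(1) by (auto dest: injD)
    moreover have "f Y_x \<subseteq> f Y_w" "f Y_y \<subseteq> f Y_x"
      using f(3)[of Y_x Y_w] f(3)[of Y_y Y_x]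
      by (auto simp: Y_poset_eq inclusion_poset_def relation_of_def)
    moreover have "f Y_w \<in> F" "f Y_x \<in> F" "f Y_y \<in> F" using f(2) by blast+
    ultimately show ?thesis using that[of "f Y_y" "f Y_x" "f Y_w"] by (simp add: psubset_eq)
  qed
qed

section \<open>The extremal number\<close>

lemma sum_largest_binomials_2:
  assumes "n \<ge> 1"
  shows "sum_largest_binomials n 2 = (n choose (n div 2)) + (n choose (n div 2 + 1))"
proof -
  define m where "m = n div 2"
  let ?f = "\<lambda>i. n choose i"
  let ?R = "[0..<m] @ [m + 2..<Suc n]"
  have "[0..<Suc n] = [0..<m] @ m # Suc m # [m + 2..<Suc n]"
  proof -
    have "[0..<Suc n] = [0..<m] @ [m..<Suc n]"
      using upt_add_eq_append[of 0 m "Suc n - m"] unfolding m_def by simp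
    moreover have "[m..<Suc n] = m # Suc m # [m + 2..<Suc n]"
      using assms unfolding m_def by (simp add: upt_conv_Cons del: upt_Suc)
    ultimately show ?thesis by simp
  qed
  \<comment> \<open>The coefficients at \<open>m\<close> and \<open>m + 1\<close> dominate all the others, so they end the sorted list.\<close>
  then have "sort (map ?f [0..<Suc n]) = sort (map ?f ?R) @ [?f (Suc m), ?f m]"
    using binomial_le_next_to_middle[of _ n] binomial_maximum[of n]
    by (intro properties_for_sort) (auto simp: sorted_append m_def simp del: upt_Suc)
  then show ?thesis
    unfolding sum_largest_binomials_def m_def by (simp add: numeral_2_eq_2 del: upt_Suc)
qed

theorem theorem6:
  fixes n :: nat
  assumes "n \<ge> 3"
  shows "La_induced n Y_poset Y_dual = sum_largest_binomials n 2"
proof -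
  let ?m = "n div 2" and ?U = "{1..n}"
  let ?ok = "\<lambda>F. F \<subseteq> Pow ?U \<and> \<not> induced_subposet Y_poset (inclusion_poset F)
      \<and> \<not> induced_subposet Y_dual (inclusion_poset F)"
  let ?K = "{card F | F. ?ok F}"
  have "Max ?K = (n choose ?m) + (n choose (?m + 1))"
  proof (rule Max_eqI)
    have "?K \<subseteq> card ` Pow (Pow ?U)" by auto
    then show "finite ?K" by (rule finite_subset) simp
  next
    fix k assume "k \<in> ?K"
    then obtain F where "k = card F" "?ok F" by blast
    then show "k \<le> (n choose ?m) + (n choose (?m + 1))"
      using card_le_two_middle_layers[of ?U F n] assms
        Y_free_if_not_induced[of F] Y_dual_free_if_not_induced[of F] by simp
  next
    let ?L = "\<lambda>k. {A. A \<subseteq> ?U \<and> card A = k}"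
    let ?F = "?L ?m \<union> ?L (?m + 1)"
    have no_chain: False
      if ABC: "A \<in> ?F" "B \<in> ?F" "C \<in> ?F" "A \<subset> B" "B \<subset> C" for A B C
    proof -
      have "finite B" "finite C" using ABC finite_subset[of _ ?U] by auto
      then have "card A < card B" "card B < card C" using ABC by (auto intro: psubset_card_mono)
      then show False using ABC by auto
    qed
    have "?ok ?F"
      using chain_of_three_if_induced[of ?F] no_chain by blast
    moreover have "card ?F = (n choose ?m) + (n choose (?m + 1))"
      by (subst card_Un_disjoint) (auto simp: n_subsets)
    ultimately show "(n choose ?m) + (n choose (?m + 1)) \<in> ?K"
      by (intro CollectI exI[of _ ?F]) simp
  qed
  then show ?thesis
    using sum_largest_binomials_2 assms unfolding La_induced_def by simp
qed

end
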